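(* Let $K$ be a finite abstract simplicial complex with geometric realization $|K|$. Then $\mathrm{cat}\,|K|\leq\mathrm{scat}(\mathrm{sd}^N K)$ for every iterated barycentric subdivision $\mathrm{sd}^N K$ of $K$.
   Context: Two simplicial maps $\varphi,\psi\colon K\to L$ between abstract simplicial complexes are contiguous, $\varphi\sim_c\psi$, if for every simplex $\sigma$ of $K$ the set of vertices $\varphi(\sigma)\cup\psi(\sigma)$ is a simplex of $L$. They are in the same contiguity class, $\varphi\sim\psi$, if there is a finite sequence of simplicial maps $\varphi=\varphi_1\sim_c\varphi_2\sim_c\cdots\sim_c\varphi_m=\psi$ from $K$ to $L$. A subcomplex $U\subset K$ is categorical (in $K$) if there is a vertex $v\in K$ such that the inclusion $U\to K$ and the constant map $c_v\colon U\to K$ with value $v$ are in the same contiguity class. The simplicial LS-category $\mathrm{scat}\, K$ is the least integer $n\geq 0$ such that $K=U_0\cup\cdots\cup U_n$ for some $n+1$ categorical subcomplexes $U_0,\dots,U_n$ of $K$. Complexes are assumed nonempty. For a topological space $X$, an open subset $U\subset X$ is categorical if it can be contracted to a point inside $X$ (the inclusion $U\to X$ is homotopic to a constant map). The LS-category $\mathrm{cat}\,X$ is the least integer $n\geq 0$ such that $X$ is covered by $n+1$ categorical open subsets. The first barycentric subdivision $\mathrm{sd}\,K$ is the abstract simplicial complex whose vertices are the (nonempty) simplices of $K$, and whose simplices are the sets $\{\sigma_1,\dots,\sigma_q\}$ of simplices of $K$ with $\sigma_1\subset\cdots\subset\sigma_q$; $\mathrm{sd}^N$ denotes its $N$-fold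 iterate. *)

theory Defs
  imports "HOL-Analysis.Analysis" "HOL-Library.FSet" "HOL-Library.Extended_Nat"
begin

section \<open>Abstract simplicial complexes\<close>

text \<open>A complex is identified with the set of its (nonempty) simplices.\<close>

definition abstract_simplicial_complex :: "'a set set \<Rightarrow> bool" where
  "abstract_simplicial_complex K \<longleftrightarrow>
     K \<noteq> {} \<and> (\<forall>\<sigma>\<in>K. finite \<sigma> \<and> \<sigma> \<noteq> {}) \<and> (\<forall>\<sigma>\<in>K. \<forall>\<tau>. \<tau> \<subseteq> \<sigma> \<longrightarrow> \<tau> \<noteq> {} \<longrightarrow> \<tau> \<in> K)"

definition vertices :: "'a set set \<Rightarrow> 'a set" where
  "vertices K = {v. {v} \<in> K}"

definition subcomplex :: "'a set set \<Rightarrow> 'a set set \<Rightarrow> bool" where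
  "subcomplex U K \<longleftrightarrow> abstract_simplicial_complex U \<and> U \<subseteq> K"

text \<open>
  Vertex maps are total functions; only their values on the vertices of the domain matter, and two
  simplicial maps that agree on those vertices are contiguous.
\<close>

definition simplicial_map :: "'a set set \<Rightarrow> 'b set set \<Rightarrow> ('a \<Rightarrow> 'b) \<Rightarrow> bool" where
  "simplicial_map K L \<phi> \<longleftrightarrow> (\<forall>\<sigma>\<in>K. \<phi> ` \<sigma> \<in> L)"

definition contiguous :: "'a set set \<Rightarrow> 'b set set \<Rightarrow> ('a \<Rightarrow> 'b) \<Rightarrow> ('a \<Rightarrow> 'b) \<Rightarrow> bool" where
  "contiguous K L \<phi> \<psi> \<longleftrightarrow>
     simplicial_map K L \<phi> \<and> simplicial_map K L \<psi> \<and> (\<forall>\<sigma>\<in>K. \<phi> ` \<sigma> \<union> \<psi> ` \<sigma> \<in> L)"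

text \<open>The first two conjuncts matter only for the chain of length zero.\<close>

definition same_contiguity_class ::
    "'a set set \<Rightarrow> 'b set set \<Rightarrow> ('a \<Rightarrow> 'b) \<Rightarrow> ('a \<Rightarrow> 'b) \<Rightarrow> bool" where
  "same_contiguity_class K L \<phi> \<psi> \<longleftrightarrow>
     simplicial_map K L \<phi> \<and> simplicial_map K L \<psi> \<and> (contiguous K L)\<^sup>*\<^sup>* \<phi> \<psi>"

definition categorical_subcomplex :: "'a set set \<Rightarrow> 'a set set \<Rightarrow> bool" where
  "categorical_subcomplex K U \<longleftrightarrow>
     subcomplex U K \<and> (\<exists>v\<in>vertices K. same_contiguity_class U K (\<lambda>x. x) (\<lambda>_. v))"

text \<open>In \<^typ>\<open>enat\<close> the infimum of the empty set is \<open>\<infinity>\<close>, so the value is \<open>\<infinity>\<close> if no finite cover exists.\<close>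

definition scat :: "'a set set \<Rightarrow> enat" where
  "scat K = (INF n \<in> {n. \<exists>U. (\<forall>i\<le>n. categorical_subcomplex K (U i)) \<and> (\<Union>i\<le>n. U i) = K}. enat n)"

section \<open>Lusternik--Schnirelmann category\<close>

definition categorical_open :: "'a topology \<Rightarrow> 'a set \<Rightarrow> bool" where
  "categorical_open X U \<longleftrightarrow>
     openin X U \<and>
     (\<exists>c\<in>topspace X. homotopic_with (\<lambda>_. True) (subtopology X U) X (\<lambda>x. x) (\<lambda>_. c))"

definition LS_cat :: "'a topology \<Rightarrow> enat" where
  "LS_cat X = (INF n \<in> {n. \<exists>U. (\<forall>i\<le>n. categorical_open X (U i)) \<and> (\<Union>i\<le>n. U i) = topspace X}. enat n)"

section \<open>Geometric realization\<close>

text \<open>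
  Points are given by barycentric coordinates. The realization carries the weak topology
  determined by its closed simplices.
\<close>

definition closed_simplex :: "'a set \<Rightarrow> ('a \<Rightarrow> real) set" where
  "closed_simplex \<sigma> = {x. (\<forall>v. 0 \<le> x v) \<and> (\<forall>v. v \<notin> \<sigma> \<longrightarrow> x v = 0) \<and> (\<Sum>v\<in>\<sigma>. x v) = 1}"

definition geometric_realization :: "'a set set \<Rightarrow> ('a \<Rightarrow> real) topology" where
  "geometric_realization K =
     topology (\<lambda>U. U \<subseteq> (\<Union>\<sigma>\<in>K. closed_simplex \<sigma>) \<and>
       (\<forall>\<sigma>\<in>K. openin (subtopology (powertop_real UNIV) (closed_simplex \<sigma>)) (U \<inter> closed_simplex \<sigma>)))"

lemma openin_geometric_realization:
  "openin (geometric_realization K) U \<longleftrightarrow> U \<subseteq> (\<Union>\<sigma>\<in>K. closed_simplex \<sigma>) \<and>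
     (\<forall>\<sigma>\<in>K. openin (subtopology (powertop_real UNIV) (closed_simplex \<sigma>)) (U \<inter> closed_simplex \<sigma>))"
proof -
  have "istopology (\<lambda>U. U \<subseteq> (\<Union>\<sigma>\<in>K. closed_simplex \<sigma>) \<and>
     (\<forall>\<sigma>\<in>K. openin (subtopology (powertop_real UNIV) (closed_simplex \<sigma>)) (U \<inter> closed_simplex \<sigma>)))"
    unfolding istopology_def
  proof (intro conjI allI impI ballI)
    fix S T \<sigma> assume
      "S \<subseteq> (\<Union>\<sigma>\<in>K. closed_simplex \<sigma>) \<and> (\<forall>\<sigma>\<in>K. openin (subtopology (powertop_real UNIV) (closed_simplex \<sigma>)) (S \<inter> closed_simplex \<sigma>))"
      "T \<subseteq> (\<Union>\<sigma>\<in>K. closed_simplex \<sigma>) \<and> (\<forall>\<sigma>\<in>K. openin (subtopology (powertop_real UNIV) (closed_simplex \<sigma>)) (T \<inter> closed_simplex \<sigma>))"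
      "\<sigma> \<in> K"
    then have "openin (subtopology (powertop_real UNIV) (closed_simplex \<sigma>))
        ((S \<inter> closed_simplex \<sigma>) \<inter> (T \<inter> closed_simplex \<sigma>))"
      by blast
    moreover have "(S \<inter> closed_simplex \<sigma>) \<inter> (T \<inter> closed_simplex \<sigma>) = S \<inter> T \<inter> closed_simplex \<sigma>"
      by blast
    ultimately show "openin (subtopology (powertop_real UNIV) (closed_simplex \<sigma>)) (S \<inter> T \<inter> closed_simplex \<sigma>)"
      by simp
  next
    fix \<U> \<sigma> assume
      "\<forall>S\<in>\<U>. S \<subseteq> (\<Union>\<sigma>\<in>K. closed_simplex \<sigma>) \<and> (\<forall>\<sigma>\<in>K. openin (subtopology (powertop_real UNIV) (closed_simplex \<sigma>)) (S \<inter> closed_simplex \<sigma>))"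
      "\<sigma> \<in> K"
    then have "openin (subtopology (powertop_real UNIV) (closed_simplex \<sigma>)) (\<Union>S\<in>\<U>. S \<inter> closed_simplex \<sigma>)"
      by blast
    moreover have "(\<Union>S\<in>\<U>. S \<inter> closed_simplex \<sigma>) = \<Union>\<U> \<inter> closed_simplex \<sigma>"
      by blast
    ultimately show "openin (subtopology (powertop_real UNIV) (closed_simplex \<sigma>)) (\<Union>\<U> \<inter> closed_simplex \<sigma>)"
      by simp
  qed blast+
  then show ?thesis
    by (simp add: geometric_realization_def topology_inverse')
qed

lemma topspace_geometric_realization:
  "topspace (geometric_realization K) = (\<Union>\<sigma>\<in>K. closed_simplex \<sigma>)"
proof -
  have "openin (subtopology (powertop_real UNIV) (closed_simplex \<sigma>)) ((\<Union>\<sigma>\<in>K. closed_simplex \<sigma>) \<inter> closed_simplex \<sigma>)"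
    if "\<sigma> \<in> K" for \<sigma>
  proof -
    have "(\<Union>\<sigma>\<in>K. closed_simplex \<sigma>) \<inter> closed_simplex \<sigma> = topspace (subtopology (powertop_real UNIV) (closed_simplex \<sigma>))"
      using that by auto
    then show ?thesis by (metis openin_topspace)
  qed
  then have "openin (geometric_realization K) (\<Union>\<sigma>\<in>K. closed_simplex \<sigma>)"
    by (simp add: openin_geometric_realization)
  then show ?thesis
    by (metis openin_geometric_realization openin_subset openin_topspace subset_antisym)
qed

lemma closed_closed_simplex: "closed (closed_simplex \<sigma>)"
proof -
  have eq: "closed_simplex \<sigma> = {x. \<forall>v. 0 \<le> x v} \<inter> {x. \<forall>v. v \<notin> \<sigma> \<longrightarrow> x v = 0} \<inter> {x. (\<Sum>v\<in>\<sigma>. x v) = 1}"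
    by (auto simp: closed_simplex_def)
  have c: "continuous_on UNIV (\<lambda>x::'a \<Rightarrow> real. x v)" for v
    by (rule continuous_on_product_coordinates)
  show ?thesis unfolding eq
    by (intro closed_Int closed_Collect_all closed_Collect_imp closed_Collect_le closed_Collect_eq
        continuous_on_sum continuous_on_const c) simp
qed

text \<open>For finite complexes the weak topology is the subspace topology.\<close>

lemma geometric_realization_finite:
  assumes "finite K"
  shows "geometric_realization K = subtopology (powertop_real UNIV) (\<Union>\<sigma>\<in>K. closed_simplex \<sigma>)"
proof -
  let ?X = "\<Union>\<sigma>\<in>K. closed_simplex \<sigma>"
  have "openin (geometric_realization K) U \<longleftrightarrow> openin (top_of_set ?X) U" for U
  proof
    assume "openin (top_of_set ?X) U"
    then obtain T where T: "open T" "U = ?X \<inter> T" by (auto simp: openin_open)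
    have "openin (top_of_set (closed_simplex \<sigma>)) (U \<inter> closed_simplex \<sigma>)" if "\<sigma> \<in> K" for \<sigma>
    proof -
      have "U \<inter> closed_simplex \<sigma> = closed_simplex \<sigma> \<inter> T" using that T(2) by blast
      then show ?thesis using T(1) by (auto simp: openin_open)
    qed
    then show "openin (geometric_realization K) U"
      using T(2) by (simp add: openin_geometric_realization euclidean_product_topology)
  next
    assume U: "openin (geometric_realization K) U"
    have "closed (closed_simplex \<sigma> - U)" if "\<sigma> \<in> K" for \<sigma>
    proof -
      have "openin (top_of_set (closed_simplex \<sigma>)) (U \<inter> closed_simplex \<sigma>)"
        using U that by (simp add: openin_geometric_realization euclidean_product_topology)
      then obtain T where "open T" "U \<inter> closed_simplex \<sigma> = closed_simplex \<sigma> \<inter> T"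
        by (auto simp: openin_open)
      moreover from this have "closed_simplex \<sigma> - U = closed_simplex \<sigma> - T" by blast
      ultimately show ?thesis by (metis closed_Diff closed_closed_simplex)
    qed
    then have cl: "closed (\<Union>\<sigma>\<in>K. closed_simplex \<sigma> - U)" using assms by (intro closed_UN) auto
    have "U = ?X \<inter> - (\<Union>\<sigma>\<in>K. closed_simplex \<sigma> - U)"
      using U by (auto simp: openin_geometric_realization)
    then show "openin (top_of_set ?X) U"
      using cl unfolding openin_open by (metis open_Compl)
  qed
  then show ?thesis by (simp add: topology_eq euclidean_product_topology)
qed

section \<open>Barycentric subdivision\<close>

definition sd :: "'a set set \<Rightarrow> 'a set set set" where
  "sd K = {set \<sigma>s | \<sigma>s. \<sigma>s \<noteq> [] \<and> set \<sigma>s \<subseteq> K \<and> sorted_wrt (\<subseteq>) \<sigma>s}"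

text \<open>
  The vertices of \<^term>\<open>sd K\<close> are simplices of \<^term>\<open>K\<close>, so iterating \<^const>\<open>sd\<close> changes
  the type at each step. To let the number of steps vary, vertices of all iterated subdivisions are
  coded in one type: \<open>Orig v\<close> is a vertex of the original complex and \<open>Simplex A\<close> is the simplex
  with vertex set \<open>A\<close> of the preceding subdivision, regarded as a vertex of the next one. The
  relabelling is injective on finite sets.
\<close>

datatype 'a sd_vertex = Orig 'a | Simplex "'a sd_vertex fset"

definition relabel :: "('a \<Rightarrow> 'b) \<Rightarrow> 'a set set \<Rightarrow> 'b set set" where
  "relabel f K = (\<lambda>\<sigma>. f ` \<sigma>) ` K"

fun sd_iter :: "nat \<Rightarrow> 'a set set \<Rightarrow> 'a sd_vertex set set" where
  "sd_iter 0 K = relabel Orig K"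
| "sd_iter (Suc N) K = relabel (\<lambda>\<sigma>. Simplex (Abs_fset \<sigma>)) (sd (sd_iter N K))"

lemma inj_on_Simplex_Abs_fset:
  assumes "abstract_simplicial_complex K"
  shows "inj_on (\<lambda>\<sigma>. Simplex (Abs_fset \<sigma>)) K"
  using assms by (auto simp: abstract_simplicial_complex_def inj_on_def Abs_fset_inject)

lemma simplicial_complex_relabel:
  assumes "abstract_simplicial_complex K"
  shows "abstract_simplicial_complex (relabel f K)"
  unfolding abstract_simplicial_complex_def
proof (intro conjI ballI allI impI)
  show "relabel f K \<noteq> {}" using assms by (auto simp: abstract_simplicial_complex_def relabel_def)
next
  fix \<sigma> assume "\<sigma> \<in> relabel f K"
  then show "finite \<sigma>" "\<sigma> \<noteq> {}" using assms by (auto simp: abstract_simplicial_complex_def relabel_def)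
next
  fix \<sigma> \<tau> assume "\<sigma> \<in> relabel f K" "\<tau> \<subseteq> \<sigma>" "\<tau> \<noteq> {}"
  then obtain \<rho> where \<rho>: "\<rho> \<in> K" "\<tau> \<subseteq> f ` \<rho>" by (auto simp: relabel_def)
  then obtain \<rho>' where "\<rho>' \<subseteq> \<rho>" "\<tau> = f ` \<rho>'" by (meson subset_imageE)
  then show "\<tau> \<in> relabel f K"
    using assms \<rho> \<open>\<tau> \<noteq> {}\<close> unfolding abstract_simplicial_complex_def relabel_def by blast
qed

lemma simplicial_complex_sd:
  assumes "abstract_simplicial_complex K"
  shows "abstract_simplicial_complex (sd K)"
  unfolding abstract_simplicial_complex_def
proof (intro conjI ballI allI impI)
  obtain \<sigma> where "\<sigma> \<in> K" using assms by (auto simp: abstract_simplicial_complex_def)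
  then have "set [\<sigma>] \<in> sd K" unfolding sd_def by fastforce
  then show "sd K \<noteq> {}" by blast
next
  fix S assume "S \<in> sd K"
  then show "finite S" "S \<noteq> {}" by (auto simp: sd_def)
next
  fix S T assume "S \<in> sd K" "T \<subseteq> S" "T \<noteq> {}"
  then obtain xs where xs: "S = set xs" "set xs \<subseteq> K" "sorted_wrt (\<subseteq>) xs" by (auto simp: sd_def)
  have "set (filter (\<lambda>x. x \<in> T) xs) = T" using xs \<open>T \<subseteq> S\<close> by auto
  moreover have "sorted_wrt (\<subseteq>) (filter (\<lambda>x. x \<in> T) xs)" using xs by (simp add: sorted_wrt_filter)
  moreover have "filter (\<lambda>x. x \<in> T) xs \<noteq> []"
    using calculation(1) \<open>T \<noteq> {}\<close> by (metis list.set(1))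
  ultimately show "T \<in> sd K"
    unfolding sd_def using xs \<open>T \<subseteq> S\<close> by (smt (verit) mem_Collect_eq subset_trans)
qed

lemma simplicial_complex_sd_iter:
  "abstract_simplicial_complex K \<Longrightarrow> abstract_simplicial_complex (sd_iter N K)"
  by (induction N) (simp_all add: simplicial_complex_relabel simplicial_complex_sd)

end

theory Submission
  imports Defs
begin

text \<open>
  Two maps into a realization are homotopic by straight lines once their values always share a closed
  simplex; in particular contiguous simplicial maps realize to homotopic maps. Sending \<open>x\<close> to its
  normalized weights on the simplices whose coordinates strictly dominate the others gives a
  continuous map from \<open>|K|\<close> to \<open>|sd K|\<close>; composing it with a simplicial map that picks a vertex of
  each simplex never leaves the carrier of \<open>x\<close>. Hence \<open>|K|\<close> is homotopy dominated by \<open>|sd K|\<close>, and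
  \<open>cat\<close> is monotone under domination. Normalizing only over the simplices of a subcomplex \<open>U\<close> gives
  in the same way an open set with a map to \<open>|U|\<close> that is homotopic in \<open>|K|\<close> to the inclusion. So
  a categorical \<open>U\<close> yields a categorical open set, and these open sets cover \<open>|K|\<close> as soon as the
  subcomplexes cover \<open>K\<close>.
\<close>

section \<open>Homotopy domination\<close>

text \<open>On the preimage of \<open>U\<close>, first move the identity to \<open>g\<close> after
  \<open>f\<close>, then push the contraction of \<open>U\<close> forward along \<open>g\<close>; it
  ends at \<open>g c\<close>.\<close>

lemma categorical_open_vimage:
  assumes f: "continuous_map X Y f" and g: "continuous_map Y X g"
    and gf: "homotopic_with (\<lambda>_. True) X X (\<lambda>x. x) (g \<circ> f)"
    and U: "categorical_open Y U"
  shows "categorical_open X {x \<in> topspace X. f x \<in> U}"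
proof -
  let ?V = "{x \<in> topspace X. f x \<in> U}"
  from U obtain c where c: "c \<in> topspace Y"
    and hom: "homotopic_with (\<lambda>_. True) (subtopology Y U) Y (\<lambda>x. x) (\<lambda>_. c)" and "openin Y U"
    by (auto simp: categorical_open_def)
  have "continuous_map (subtopology X ?V) (subtopology Y U) f"
    using f by (auto simp: continuous_map_in_subtopology continuous_map_from_subtopology)
  then have "homotopic_with (\<lambda>_. True) (subtopology X ?V) X (g \<circ> ((\<lambda>x. x) \<circ> f)) (g \<circ> ((\<lambda>_. c) \<circ> f))"
    by (intro homotopic_with_compose_continuous_map_left [OF _ g]
        homotopic_with_compose_continuous_map_right [OF hom]) auto
  then have "homotopic_with (\<lambda>_. True) (subtopology X ?V) X (g \<circ> f) (\<lambda>_. g c)"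
    by (simp add: o_def)
  with homotopic_from_subtopology [OF gf]
  have "homotopic_with (\<lambda>_. True) (subtopology X ?V) X (\<lambda>x. x) (\<lambda>_. g c)"
    by (rule homotopic_with_trans)
  moreover have "g c \<in> topspace X"
    using g c by (auto simp: continuous_map_def)
  moreover have "openin X ?V"
    using openin_continuous_map_preimage [OF f \<open>openin Y U\<close>] .
  ultimately show ?thesis
    by (auto simp: categorical_open_def)
qed

text \<open>Pulling a cover back along \<open>f\<close> keeps its number of members, so every
  \<open>n\<close> admissible for \<open>Y\<close> is admissible for \<open>X\<close>.\<close>

lemma LS_cat_le_dominated:
  assumes f: "continuous_map X Y f" and g: "continuous_map Y X g"
    and gf: "homotopic_with (\<lambda>_. True) X X (\<lambda>x. x) (g \<circ> f)"
  shows "LS_cat X \<le> LS_cat Y"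
  unfolding LS_cat_def
proof (rule INF_superset_mono)
  show "{n. \<exists>U. (\<forall>i\<le>n. categorical_open Y (U i)) \<and> (\<Union>i\<le>n. U i) = topspace Y}
      \<subseteq> {n. \<exists>U. (\<forall>i\<le>n. categorical_open X (U i)) \<and> (\<Union>i\<le>n. U i) = topspace X}"
  proof
    fix n assume "n \<in> {n. \<exists>U. (\<forall>i\<le>n. categorical_open Y (U i)) \<and> (\<Union>i\<le>n. U i) = topspace Y}"
    then obtain U where cat: "\<forall>i\<le>n. categorical_open Y (U i)" and cov: "(\<Union>i\<le>n. U i) = topspace Y"
      by auto
    have "\<forall>i\<le>n. categorical_open X {x \<in> topspace X. f x \<in> U i}"
      using categorical_open_vimage [OF f g gf] cat by blast
    moreover have "(\<Union>i\<le>n. {x \<in> topspace X. f x \<in> U i}) = topspace X"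
    proof -
      have "f x \<in> (\<Union>i\<le>n. U i)" if "x \<in> topspace X" for x
        using that f cov by (auto simp: continuous_map_def)
      then show ?thesis by fast
    qed
    ultimately show "n \<in> {n. \<exists>V. (\<forall>i\<le>n. categorical_open X (V i)) \<and> (\<Union>i\<le>n. V i) = topspace X}"
      by (intro CollectI exI [of _ "\<lambda>i. {x \<in> topspace X. f x \<in> U i}"] conjI)
  qed
qed simp

section \<open>Maps into geometric realizations\<close>

lemma closed_simplex_mono:
  assumes "\<sigma> \<subseteq> \<tau>" "finite \<tau>"
  shows "closed_simplex \<sigma> \<subseteq> closed_simplex \<tau>"
proof
  fix x assume x: "x \<in> closed_simplex \<sigma>"
  then have "sum x \<tau> = sum x \<sigma>"
    using assms by (intro sum.mono_neutral_right) (auto simp: closed_simplex_def)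
  with x assms show "x \<in> closed_simplex \<tau>"
    by (auto simp: closed_simplex_def)
qed

lemma closed_simplex_support:
  assumes "x \<in> closed_simplex \<sigma>" "finite \<sigma>"
  shows "x \<in> closed_simplex {v. x v \<noteq> 0}" "{v. x v \<noteq> 0} \<subseteq> \<sigma>" "{v. x v \<noteq> 0} \<noteq> {}"
proof -
  show sub: "{v. x v \<noteq> 0} \<subseteq> \<sigma>"
    using assms by (auto simp: closed_simplex_def)
  have "sum x {v. x v \<noteq> 0} = sum x \<sigma>"
    using assms sub by (intro sum.mono_neutral_left) auto
  then have sum: "sum x {v. x v \<noteq> 0} = 1"
    using assms by (auto simp: closed_simplex_def)
  then show "x \<in> closed_simplex {v. x v \<noteq> 0}"
    using assms by (auto simp: closed_simplex_def)
  show "{v. x v \<noteq> 0} \<noteq> {}"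
    using sum by (metis sum.empty zero_neq_one)
qed

text \<open>The support of a point is its carrier, the smallest simplex whose closed simplex
  contains it. It serves below as a canonical common simplex for homotopies.\<close>

lemma support_in_complex:
  assumes K: "abstract_simplicial_complex K" and x: "x \<in> topspace (geometric_realization K)"
  shows "{v. x v \<noteq> 0} \<in> K" "x \<in> closed_simplex {v. x v \<noteq> 0}"
proof -
  obtain \<sigma> where \<sigma>: "\<sigma> \<in> K" "x \<in> closed_simplex \<sigma>"
    using x by (auto simp: topspace_geometric_realization)
  then have "finite \<sigma>"
    using K by (auto simp: abstract_simplicial_complex_def)
  note * = closed_simplex_support [OF \<sigma>(2) this]
  show "{v. x v \<noteq> 0} \<in> K"
    using *(2,3) \<sigma>(1) K unfolding abstract_simplicial_complex_def by blast
  show "x \<in> closed_simplex {v. x v \<noteq> 0}"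
    by (rule *)
qed

text \<open>For finite \<open>K\<close> the weak topology is the subspace topology of a product, so
  continuity is tested coordinate by coordinate.\<close>

lemma continuous_map_into_realization:
  assumes "finite K"
  shows "continuous_map X (geometric_realization K) f \<longleftrightarrow>
    (\<forall>v. continuous_map X euclideanreal (\<lambda>x. f x v)) \<and>
    (\<forall>x\<in>topspace X. \<exists>\<sigma>\<in>K. f x \<in> closed_simplex \<sigma>)"
  using assms
  by (auto simp: geometric_realization_finite continuous_map_in_subtopology
      continuous_map_componentwise_UNIV Pi_iff)

lemma continuous_map_realization_coordinate:
  assumes "finite K"
  shows "continuous_map (geometric_realization K) euclideanreal (\<lambda>x. x v)"
  using continuous_map_into_realization [OF assms, of "geometric_realization K" "\<lambda>x. x"]
  by simp

lemma convex_closed_simplex: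
  assumes "x \<in> closed_simplex \<sigma>" "y \<in> closed_simplex \<sigma>" "0 \<le> t" "t \<le> 1"
  shows "(\<lambda>v. (1 - t) * x v + t * y v) \<in> closed_simplex \<sigma>"
proof -
  have "(\<Sum>v\<in>\<sigma>. (1 - t) * x v + t * y v) = (1 - t) * sum x \<sigma> + t * sum y \<sigma>"
    by (simp add: sum.distrib sum_distrib_left)
  with assms show ?thesis
    by (auto simp: closed_simplex_def)
qed

text \<open>Closed simplices are convex, so the segment from \<open>f x\<close> to
  \<open>g x\<close> stays in the realization. The common simplex may vary with \<open>x\<close> in
  any manner, because continuity is checked on coordinates only.\<close>

lemma homotopic_common_carrier:
  assumes "finite K"
    and f: "continuous_map X (geometric_realization K) f"
    and g: "continuous_map X (geometric_realization K) g"
    and carrier: "\<And>x. x \<in> topspace X \<Longrightarrow> \<exists>\<sigma>\<in>K. f x \<in> closed_simplex \<sigma> \<and> g x \<in> closed_simplex \<sigma>"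
  shows "homotopic_with (\<lambda>_. True) X (geometric_realization K) f g"
proof -
  let ?P = "prod_topology (top_of_set {0..1::real}) X"
  let ?h = "\<lambda>p v. (1 - fst p) * f (snd p) v + fst p * g (snd p) v"
  have t: "continuous_map ?P euclideanreal fst"
    using continuous_map_fst continuous_map_into_fulltopology by blast
  have fv: "continuous_map ?P euclideanreal (\<lambda>p. f (snd p) v)" for v
    using continuous_map_compose [OF continuous_map_snd, of X euclideanreal "\<lambda>x. f x v"] f assms(1)
    by (auto simp: continuous_map_into_realization o_def)
  have gv: "continuous_map ?P euclideanreal (\<lambda>p. g (snd p) v)" for v
    using continuous_map_compose [OF continuous_map_snd, of X euclideanreal "\<lambda>x. g x v"] g assms(1)
    by (auto simp: continuous_map_into_realization o_def)
  have "\<exists>\<sigma>\<in>K. ?h p \<in> closed_simplex \<sigma>" if "p \<in> topspace ?P" for p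
  proof -
    have "snd p \<in> topspace X" and t: "0 \<le> fst p" "fst p \<le> 1"
      using that by auto
    then obtain \<sigma> where "\<sigma> \<in> K" "f (snd p) \<in> closed_simplex \<sigma>" "g (snd p) \<in> closed_simplex \<sigma>"
      using carrier by blast
    with t show ?thesis
      using convex_closed_simplex by blast
  qed
  then have "continuous_map ?P (geometric_realization K) ?h"
    unfolding continuous_map_into_realization [OF assms(1)]
    by (intro conjI allI ballI continuous_intros t fv gv) auto
  then show ?thesis
    unfolding homotopic_with_def by (intro exI [of _ ?h]) auto
qed

section \<open>Realization of simplicial maps\<close>

text \<open>The fibre is cut down to vertices of \<open>K\<close> to keep it finite: a sum over an
  infinite set would be 0 by default.\<close>

definition realization_map :: "'a set set \<Rightarrow> ('a \<Rightarrow> 'b) \<Rightarrow> ('a \<Rightarrow> real) \<Rightarrow> 'b \<Rightarrow> real" where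
  "realization_map K \<phi> x w = (\<Sum>v \<in> {v \<in> \<Union>K. \<phi> v = w}. x v)"

lemma finite_Union_complex:
  "abstract_simplicial_complex K \<Longrightarrow> finite K \<Longrightarrow> finite (\<Union>K)"
  by (auto simp: abstract_simplicial_complex_def)

lemma finite_vertex_fibre:
  assumes "abstract_simplicial_complex K" "finite K"
  shows "finite {v \<in> \<Union>K. \<phi> v = w}"
  by (rule finite_subset [OF _ finite_Union_complex [OF assms]]) blast

text \<open>Grouping the coordinates of \<open>x\<close> by the fibres of \<open>\<phi>\<close>
  preserves their total, which is 1.\<close>

lemma realization_map_closed_simplex:
  assumes K: "abstract_simplicial_complex K" "finite K" and \<sigma>: "\<sigma> \<in> K" and x: "x \<in> closed_simplex \<sigma>"
  shows "realization_map K \<phi> x \<in> closed_simplex (\<phi> ` \<sigma>)"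
proof -
  have fin: "finite \<sigma>"
    using K \<sigma> by (auto simp: abstract_simplicial_complex_def)
  \<comment> \<open>Coordinates outside \<open>\<sigma>\<close> vanish, so each fibre may be
    intersected with \<open>\<sigma>\<close>.\<close>
  have eq: "realization_map K \<phi> x w = (\<Sum>v \<in> {v \<in> \<sigma>. \<phi> v = w}. x v)" for w
    unfolding realization_map_def
    using x \<sigma> by (intro sum.mono_neutral_right finite_vertex_fibre K) (auto simp: closed_simplex_def)
  have "(\<Sum>w\<in>\<phi> ` \<sigma>. realization_map K \<phi> x w) = sum x \<sigma>"
    unfolding eq using fin by (simp add: sum.image_gen [symmetric])
  moreover have "0 \<le> realization_map K \<phi> x w" for w
    unfolding realization_map_def using x by (intro sum_nonneg) (auto simp: closed_simplex_def)
  moreover have "realization_map K \<phi> x w = 0" if "w \<notin> \<phi> ` \<sigma>" for w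
    unfolding eq using that by (intro sum.neutral) auto
  ultimately show ?thesis
    using x by (simp add: closed_simplex_def)
qed

lemma continuous_map_realization_map:
  assumes K: "abstract_simplicial_complex K" "finite K" and "finite L" and \<phi>: "simplicial_map K L \<phi>"
  shows "continuous_map (geometric_realization K) (geometric_realization L) (realization_map K \<phi>)"
  unfolding continuous_map_into_realization [OF \<open>finite L\<close>]
proof (intro conjI allI ballI)
  fix w
  show "continuous_map (geometric_realization K) euclideanreal (\<lambda>x. realization_map K \<phi> x w)"
    unfolding realization_map_def
    by (intro continuous_intros continuous_map_realization_coordinate finite_vertex_fibre K)
next
  fix x assume "x \<in> topspace (geometric_realization K)"
  then obtain \<sigma> where "\<sigma> \<in> K" "x \<in> closed_simplex \<sigma>"
    by (auto simp: topspace_geometric_realization)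
  then show "\<exists>\<tau>\<in>L. realization_map K \<phi> x \<in> closed_simplex \<tau>"
    using realization_map_closed_simplex [OF K] \<phi> unfolding simplicial_map_def by blast
qed

text \<open>If \<open>x\<close> lies in the closed simplex of \<open>\<sigma>\<close>, contiguity
  makes the union of the two images of \<open>\<sigma>\<close> a simplex, which carries both image
  points.\<close>

lemma homotopic_realization_contiguous:
  assumes K: "abstract_simplicial_complex K" "finite K" and L: "abstract_simplicial_complex L" "finite L"
    and c: "contiguous K L \<phi> \<psi>"
  shows "homotopic_with (\<lambda>_. True) (geometric_realization K) (geometric_realization L)
    (realization_map K \<phi>) (realization_map K \<psi>)"
proof (rule homotopic_common_carrier)
  fix x assume "x \<in> topspace (geometric_realization K)"
  then obtain \<sigma> where \<sigma>: "\<sigma> \<in> K" "x \<in> closed_simplex \<sigma>"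
    by (auto simp: topspace_geometric_realization)
  then have un: "\<phi> ` \<sigma> \<union> \<psi> ` \<sigma> \<in> L"
    using c by (auto simp: contiguous_def)
  then have "finite (\<phi> ` \<sigma> \<union> \<psi> ` \<sigma>)"
    using L by (auto simp: abstract_simplicial_complex_def)
  then show "\<exists>\<tau>\<in>L. realization_map K \<phi> x \<in> closed_simplex \<tau> \<and> realization_map K \<psi> x \<in> closed_simplex \<tau>"
    using un realization_map_closed_simplex [OF K \<sigma>] closed_simplex_mono
    by (meson Un_upper1 Un_upper2 subsetD)
qed (use assms in \<open>auto simp: contiguous_def intro: continuous_map_realization_map\<close>)

lemma homotopic_realization_same_contiguity_class:
  assumes K: "abstract_simplicial_complex K" "finite K" and L: "abstract_simplicial_complex L" "finite L"
    and c: "same_contiguity_class K L \<phi> \<psi>"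
  shows "homotopic_with (\<lambda>_. True) (geometric_realization K) (geometric_realization L)
    (realization_map K \<phi>) (realization_map K \<psi>)"
proof -
  from c have "(contiguous K L)\<^sup>*\<^sup>* \<phi> \<psi>" and \<phi>: "simplicial_map K L \<phi>"
    by (auto simp: same_contiguity_class_def)
  then show ?thesis
  proof (induction rule: rtranclp_induct)
    \<comment> \<open>Reflexivity of homotopy requires a continuous map; this is where simpliciality
      of \<open>\<phi>\<close> enters for a chain of length zero.\<close>
    case base
    then show ?case
      using continuous_map_realization_map [OF K L(2)] by (simp add: homotopic_with_refl)
  next
    case (step \<psi> \<chi>)
    then show ?case
      using homotopic_realization_contiguous [OF K L] homotopic_with_trans by blast
  qed
qed

lemma realization_map_id:
  assumes K: "abstract_simplicial_complex K" and x: "x \<in> topspace (geometric_realization K)"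
  shows "realization_map K (\<lambda>v. v) x = x"
proof
  fix w
  have "x w = 0" if "w \<notin> \<Union>K"
    using that support_in_complex [OF assms] by blast
  moreover have "{v \<in> \<Union>K. v = w} = (if w \<in> \<Union>K then {w} else {})"
    by auto
  ultimately show "realization_map K (\<lambda>v. v) x w = x w"
    by (simp add: realization_map_def)
qed

lemma realization_map_const:
  assumes K: "abstract_simplicial_complex K" "finite K" and x: "x \<in> topspace (geometric_realization K)"
  shows "realization_map K (\<lambda>_. u) x = (\<lambda>w. if w = u then 1 else 0)"
proof -
  obtain \<sigma> where \<sigma>: "\<sigma> \<in> K" "x \<in> closed_simplex \<sigma>"
    using x by (auto simp: topspace_geometric_realization)
  then have "realization_map K (\<lambda>_. u) x \<in> closed_simplex {u}"
    \<comment> \<open>A simplex is nonempty, so its image under the constant map is exactly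
      \<open>{u}\<close>; the closed simplex of \<open>{u}\<close> is a single point.\<close>
    using realization_map_closed_simplex [OF K \<sigma>, of "\<lambda>_. u"] K(1)
    by (auto simp: abstract_simplicial_complex_def image_constant_conv)
  then show ?thesis
    by (auto simp: closed_simplex_def)
qed

section \<open>Barycentric coordinates in the subdivision\<close>

text \<open>Trades sorted lists for finite chains. Conversely, sorting a chain by cardinality gives
  the list: comparable finite sets are nested in the order of their sizes.\<close>

lemma sd_iff:
  assumes "abstract_simplicial_complex K"
  shows "S \<in> sd K \<longleftrightarrow> finite S \<and> S \<noteq> {} \<and> S \<subseteq> K \<and> (\<forall>\<sigma>\<in>S. \<forall>\<tau>\<in>S. \<sigma> \<subseteq> \<tau> \<or> \<tau> \<subseteq> \<sigma>)"
proof
  assume "S \<in> sd K"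
  then obtain xs where xs: "S = set xs" "xs \<noteq> []" "set xs \<subseteq> K" "sorted_wrt (\<subseteq>) xs"
    by (auto simp: sd_def)
  from xs(4) have "\<forall>\<sigma>\<in>set xs. \<forall>\<tau>\<in>set xs. \<sigma> \<subseteq> \<tau> \<or> \<tau> \<subseteq> \<sigma>"
    by (induction xs) auto
  with xs show "finite S \<and> S \<noteq> {} \<and> S \<subseteq> K \<and> (\<forall>\<sigma>\<in>S. \<forall>\<tau>\<in>S. \<sigma> \<subseteq> \<tau> \<or> \<tau> \<subseteq> \<sigma>)"
    by simp
next
  assume S: "finite S \<and> S \<noteq> {} \<and> S \<subseteq> K \<and> (\<forall>\<sigma>\<in>S. \<forall>\<tau>\<in>S. \<sigma> \<subseteq> \<tau> \<or> \<tau> \<subseteq> \<sigma>)"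
  then obtain ys where ys: "set ys = S"
    using finite_list [of S] by auto
  define xs where "xs = sort_key card ys"
  have xs: "set xs = S"
    by (simp add: xs_def ys)
  have "sorted_wrt (\<lambda>\<sigma> \<tau>. card \<sigma> \<le> card \<tau>) xs"
    using sorted_sort_key [of card ys] by (simp add: xs_def sorted_wrt_map)
  then have "sorted_wrt (\<subseteq>) xs"
  proof (rule sorted_wrt_mono_rel [rotated])
    fix \<sigma> \<tau> assume "\<sigma> \<in> set xs" "\<tau> \<in> set xs" "card \<sigma> \<le> card \<tau>"
    moreover from this have "finite \<sigma>"
      using S assms xs by (auto simp: abstract_simplicial_complex_def)
    moreover have "\<sigma> \<subseteq> \<tau> \<or> \<tau> \<subseteq> \<sigma>"
      using S xs calculation by simp
    ultimately show "\<sigma> \<subseteq> \<tau>"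
      using card_seteq [of \<sigma> \<tau>] by auto
  qed
  moreover have "xs \<noteq> []"
    using xs S by auto
  ultimately show "S \<in> sd K"
    using xs S by (auto simp: sd_def intro: exI [of _ xs])
qed

lemma finite_sd:
  assumes "finite K" shows "finite (sd K)"
proof -
  have "sd K \<subseteq> Pow K"
    by (auto simp: sd_def)
  then show ?thesis
    using assms finite_subset by blast
qed

text \<open>A finite nonempty chain contains its union, namely its largest member.\<close>

lemma sd_Union:
  assumes "abstract_simplicial_complex K" "S \<in> sd K"
  shows "\<Union>S \<in> K"
proof -
  have "subset.chain UNIV S" "finite S" "S \<noteq> {}" "S \<subseteq> K"
    using assms by (auto simp: sd_iff subset_chain_def)
  then show ?thesis
    using Union_in_chain by blast
qed

text \<open>An arbitrary choice function; as a vertex map from \<open>sd K\<close> to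
  \<open>K\<close> it is the classical simplicial approximation of the identity.\<close>

definition some_vertex :: "'a set \<Rightarrow> 'a" where
  "some_vertex \<sigma> = (SOME v. v \<in> \<sigma>)"

lemma some_vertex_in: "\<sigma> \<noteq> {} \<Longrightarrow> some_vertex \<sigma> \<in> \<sigma>"
  by (simp add: some_vertex_def some_in_eq)

lemma some_vertex_image_subset:
  assumes "abstract_simplicial_complex K" "S \<in> sd K"
  shows "some_vertex ` S \<subseteq> \<Union>S"
proof (rule image_subsetI)
  fix \<sigma> assume \<sigma>: "\<sigma> \<in> S"
  then have "\<sigma> \<in> K"
    using assms(2) by (auto simp: sd_iff [OF assms(1)])
  then have "\<sigma> \<noteq> {}"
    using assms(1) by (auto simp: abstract_simplicial_complex_def)
  from some_vertex_in [OF this] show "some_vertex \<sigma> \<in> \<Union>S"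
    using \<sigma> by (rule UnionI [rotated])
qed

text \<open>All chosen vertices of a chain lie in its largest simplex.\<close>

lemma simplicial_map_some_vertex:
  assumes K: "abstract_simplicial_complex K"
  shows "simplicial_map (sd K) K some_vertex"
  unfolding simplicial_map_def
proof
  fix S assume S: "S \<in> sd K"
  then have "some_vertex ` S \<noteq> {}"
    using K by (auto simp: sd_iff)
  then show "some_vertex ` S \<in> K"
    using sd_Union [OF K S] some_vertex_image_subset [OF K S] K
    unfolding abstract_simplicial_complex_def by blast
qed

text \<open>
  The weight is a substitute for the exact coordinate of \<open>x\<close> at the vertex \<open>\<sigma>\<close> of the subdivision,
  which is \<open>card \<sigma>\<close> times the positive part of the least coordinate in \<open>\<sigma>\<close> minus the greatest one
  outside \<open>\<sigma>\<close>. Both are positive for the same \<open>\<sigma>\<close>, but the product is visibly continuous.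
\<close>

definition flag_weight :: "'a set set \<Rightarrow> ('a \<Rightarrow> real) \<Rightarrow> 'a set \<Rightarrow> real" where
  "flag_weight K x \<sigma> = (\<Prod>v\<in>\<sigma>. x v * (\<Prod>w \<in> \<Union>K - \<sigma>. max 0 (x v - x w)))"

definition flag_support :: "'a set set \<Rightarrow> 'a set set \<Rightarrow> ('a \<Rightarrow> real) \<Rightarrow> 'a set set" where
  "flag_support K U x = {\<sigma> \<in> U. 0 < flag_weight K x \<sigma>}"

text \<open>The weights compare with all vertices of \<open>K\<close>; only the normalization is
  restricted to \<open>U\<close>. Coordinates at simplices outside \<open>U\<close> are dropped, as
  in the usual projection near the full subcomplex \<open>sd U\<close> of
  \<open>sd K\<close>.\<close>

definition flag_map :: "'a set set \<Rightarrow> 'a set set \<Rightarrow> ('a \<Rightarrow> real) \<Rightarrow> 'a set \<Rightarrow> real" where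
  "flag_map K U x \<sigma> = (if \<sigma> \<in> U then flag_weight K x \<sigma> / (\<Sum>\<tau>\<in>U. flag_weight K x \<tau>) else 0)"

text \<open>Under the identification of |K| with |sd K|, this is the union of the open stars of the
  barycentres of simplices of \<open>U\<close>.\<close>

definition flag_neighbourhood :: "'a set set \<Rightarrow> 'a set set \<Rightarrow> ('a \<Rightarrow> real) set" where
  "flag_neighbourhood K U = {x \<in> topspace (geometric_realization K). flag_support K U x \<noteq> {}}"

lemma flag_weight_nonneg:
  assumes "\<And>v. 0 \<le> x v" shows "0 \<le> flag_weight K x \<sigma>"
  unfolding flag_weight_def by (intro prod_nonneg mult_nonneg_nonneg assms ballI) auto

text \<open>A product of nonnegative factors is positive iff none vanishes; finiteness of both index
  sets excludes the default value 1 of infinite products.\<close>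

lemma flag_weight_pos_iff:
  assumes K: "abstract_simplicial_complex K" "finite K" and "\<sigma> \<in> K" and x: "\<And>v. 0 \<le> x v"
  shows "0 < flag_weight K x \<sigma> \<longleftrightarrow> (\<forall>v\<in>\<sigma>. 0 < x v \<and> (\<forall>w\<in>\<Union>K - \<sigma>. x w < x v))"
proof -
  have fin: "finite \<sigma>" "finite (\<Union>K - \<sigma>)"
    using assms finite_Union_complex [OF K] by (auto simp: abstract_simplicial_complex_def)
  have "0 < flag_weight K x \<sigma> \<longleftrightarrow> flag_weight K x \<sigma> \<noteq> 0"
    using flag_weight_nonneg [where x = x and K = K and \<sigma> = \<sigma>, OF x] by linarith
  also have "\<dots> \<longleftrightarrow> (\<forall>v\<in>\<sigma>. x v \<noteq> 0 \<and> (\<forall>w\<in>\<Union>K - \<sigma>. max 0 (x v - x w) \<noteq> 0))"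
    using fin by (simp add: flag_weight_def)
  also have "\<dots> \<longleftrightarrow> (\<forall>v\<in>\<sigma>. 0 < x v \<and> (\<forall>w\<in>\<Union>K - \<sigma>. x w < x v))"
  proof -
    have "x v \<noteq> 0 \<longleftrightarrow> 0 < x v" for v
      using x [of v] by linarith
    moreover have "max 0 (x v - x w) \<noteq> 0 \<longleftrightarrow> x w < x v" for v w
      by linarith
    ultimately show ?thesis by simp
  qed
  finally show ?thesis .
qed

lemma continuous_map_flag_weight:
  assumes K: "abstract_simplicial_complex K" "finite K" and "\<sigma> \<in> K"
  shows "continuous_map (geometric_realization K) euclideanreal (\<lambda>x. flag_weight K x \<sigma>)"
proof -
  have fin: "finite \<sigma>" "finite (\<Union>K - \<sigma>)"
    using assms finite_Union_complex [OF K] by (auto simp: abstract_simplicial_complex_def)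
  show ?thesis
    unfolding flag_weight_def
    by (intro continuous_intros continuous_map_realization_coordinate K fin) auto
qed

lemma realization_nonneg: "x \<in> topspace (geometric_realization K) \<Longrightarrow> 0 \<le> x v"
  by (auto simp: topspace_geometric_realization closed_simplex_def)

text \<open>For incomparable simplices take \<open>v\<close> in the first only and \<open>w\<close>
  in the second only: positive weights would force both \<open>x w < x v\<close> and
  \<open>x v < x w\<close>. So the support is a chain.\<close>

lemma flag_support_in_sd:
  assumes K: "abstract_simplicial_complex K" "finite K" and U: "subcomplex U K"
    and x: "x \<in> flag_neighbourhood K U"
  shows "flag_support K U x \<in> sd U"
proof -
  have x0: "0 \<le> x v" for v
    using x by (intro realization_nonneg [of x K]) (simp add: flag_neighbourhood_def)
  have UK: "abstract_simplicial_complex U" "U \<subseteq> K" "finite U"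
    using U K finite_subset by (auto simp: subcomplex_def)
  have "\<sigma> \<subseteq> \<tau> \<or> \<tau> \<subseteq> \<sigma>" if \<sigma>: "\<sigma> \<in> flag_support K U x" and \<tau>: "\<tau> \<in> flag_support K U x" for \<sigma> \<tau>
  proof (rule ccontr)
    assume "\<not> ?thesis"
    then obtain v w where vw: "v \<in> \<sigma>" "v \<notin> \<tau>" "w \<in> \<tau>" "w \<notin> \<sigma>"
      by blast
    have K\<sigma>: "\<sigma> \<in> K" "\<tau> \<in> K" and pos: "0 < flag_weight K x \<sigma>" "0 < flag_weight K x \<tau>"
      using \<sigma> \<tau> UK by (auto simp: flag_support_def)
    have "x w < x v"
      using pos(1) vw K\<sigma> unfolding flag_weight_pos_iff [where x = x, OF K K\<sigma>(1) x0] by blast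
    moreover have "x v < x w"
      using pos(2) vw K\<sigma> unfolding flag_weight_pos_iff [where x = x, OF K K\<sigma>(2) x0] by blast
    ultimately show False
      by simp
  qed
  moreover have "flag_support K U x \<noteq> {}" "flag_support K U x \<subseteq> U"
    using x by (auto simp: flag_neighbourhood_def flag_support_def)
  ultimately show ?thesis
    using UK finite_subset [of "flag_support K U x" U] by (auto simp: sd_iff)
qed

text \<open>Each \<open>x v\<close> with \<open>v\<close> in \<open>\<sigma>\<close> is a factor of
  the weight. Hence vertices picked from the supporting simplices stay in the carrier of
  \<open>x\<close>.\<close>

lemma flag_support_subset_support:
  assumes K: "abstract_simplicial_complex K" "finite K" and U: "subcomplex U K"
    and x: "x \<in> topspace (geometric_realization K)"
  shows "\<Union>(flag_support K U x) \<subseteq> {v. x v \<noteq> 0}"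
proof clarify
  fix v \<sigma> assume \<sigma>: "v \<in> \<sigma>" "\<sigma> \<in> flag_support K U x" and "x v = 0"
  then have "\<sigma> \<in> K" "0 < flag_weight K x \<sigma>"
    using U by (auto simp: flag_support_def subcomplex_def)
  then show False
    using flag_weight_pos_iff [where x = x, OF K _ realization_nonneg [OF x]] \<sigma>(1) \<open>x v = 0\<close> by force
qed

lemma flag_weight_sum_pos:
  assumes "finite U" and x: "x \<in> flag_neighbourhood K U"
  shows "0 < (\<Sum>\<tau>\<in>U. flag_weight K x \<tau>)"
proof -
  have "0 \<le> x v" for v
    using x by (intro realization_nonneg [of x K]) (simp add: flag_neighbourhood_def)
  moreover obtain \<sigma> where "\<sigma> \<in> U" "0 < flag_weight K x \<sigma>"
    using x by (auto simp: flag_neighbourhood_def flag_support_def)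
  ultimately show ?thesis
    using assms(1) by (intro sum_pos2) (auto intro: flag_weight_nonneg)
qed

lemma flag_map_closed_simplex:
  assumes "finite U" and x: "x \<in> flag_neighbourhood K U"
  shows "flag_map K U x \<in> closed_simplex (flag_support K U x)"
proof -
  let ?s = "\<Sum>\<tau>\<in>U. flag_weight K x \<tau>"
  have s: "0 < ?s"
    using flag_weight_sum_pos [OF assms] .
  have x0: "0 \<le> flag_weight K x \<sigma>" for \<sigma>
    using x by (intro flag_weight_nonneg realization_nonneg [of x K]) (simp add: flag_neighbourhood_def)
  \<comment> \<open>Weights are nonnegative, so a weight that is not positive is 0.\<close>
  have zero: "flag_map K U x \<sigma> = 0" if "\<sigma> \<notin> flag_support K U x" for \<sigma>
    using that x0 [of \<sigma>] by (auto simp: flag_map_def flag_support_def)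
  have "sum (flag_map K U x) (flag_support K U x) = sum (flag_map K U x) U"
    using assms(1) zero by (intro sum.mono_neutral_left) (auto simp: flag_support_def)
  also have "\<dots> = (\<Sum>\<sigma>\<in>U. flag_weight K x \<sigma> / ?s)"
    by (simp add: flag_map_def)
  also have "\<dots> = 1"
    using s by (simp add: sum_divide_distrib [symmetric])
  finally show ?thesis
    using zero x0 s by (auto simp: closed_simplex_def flag_map_def)
qed

lemma continuous_map_flag_map:
  assumes K: "abstract_simplicial_complex K" "finite K" and U: "subcomplex U K"
  shows "continuous_map (subtopology (geometric_realization K) (flag_neighbourhood K U))
    (geometric_realization (sd U)) (flag_map K U)"
proof -
  have UK: "U \<subseteq> K" "finite U"
    using U K finite_subset by (auto simp: subcomplex_def)
  show ?thesis
    unfolding continuous_map_into_realization [OF finite_sd [OF UK(2)]]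
  proof (intro conjI allI ballI)
    fix \<sigma>
    \<comment> \<open>The quotient is continuous because its denominator is positive throughout the
      neighbourhood.\<close>
    have "continuous_map (subtopology (geometric_realization K) (flag_neighbourhood K U)) euclideanreal
        (\<lambda>x. flag_weight K x \<sigma> / (\<Sum>\<tau>\<in>U. flag_weight K x \<tau>))" if "\<sigma> \<in> U"
      using that UK flag_weight_sum_pos [OF UK(2)]
      by (intro continuous_intros continuous_map_from_subtopology continuous_map_flag_weight K) force+
    then show "continuous_map (subtopology (geometric_realization K) (flag_neighbourhood K U))
        euclideanreal (\<lambda>x. flag_map K U x \<sigma>)"
      by (cases "\<sigma> \<in> U") (simp_all add: flag_map_def)
  next
    fix x assume "x \<in> topspace (subtopology (geometric_realization K) (flag_neighbourhood K U))"
    then have "x \<in> flag_neighbourhood K U"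
      by auto
    then show "\<exists>S\<in>sd U. flag_map K U x \<in> closed_simplex S"
      using flag_support_in_sd [OF K U] flag_map_closed_simplex [OF UK(2)] by blast
  qed
qed

text \<open>The simplex spanned by the vertices at which \<open>x\<close> attains its maximum has positive weight.\<close>

lemma flag_support_nonempty:
  assumes K: "abstract_simplicial_complex K" "finite K"
    and x: "x \<in> topspace (geometric_realization K)"
  shows "flag_support K K x \<noteq> {}"
proof -
  let ?T = "{v. x v \<noteq> 0}"
  \<comment> \<open>The maximum is taken over the support, which is finite and nonempty. Since
    \<open>m\<close> turns out positive, it also bounds the zero coordinates, and the level set
    \<open>\<sigma>\<close> lies in the support.\<close>
  define m where "m = Max (x ` ?T)"
  define \<sigma> where "\<sigma> = {v. x v = m}"
  have T: "?T \<in> K"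
    using support_in_complex [OF K(1) x] by blast
  then have fin: "finite ?T" "?T \<noteq> {}"
    using K by (auto simp: abstract_simplicial_complex_def)
  have x0: "0 \<le> x v" for v
    using realization_nonneg [OF x] .
  have "m \<in> x ` ?T"
    unfolding m_def using fin by (intro Max_in) auto
  then obtain u where u: "m = x u" "x u \<noteq> 0"
    by blast
  then have m: "0 < m"
    using x0 [of u] by simp
  have le: "x v \<le> m" for v
  proof (cases "x v = 0")
    case False
    then show ?thesis
      unfolding m_def using fin by (intro Max_ge) auto
  qed (use m in simp)
  have "\<sigma> \<subseteq> ?T" "\<sigma> \<noteq> {}"
    using m u by (auto simp: \<sigma>_def)
  then have \<sigma>: "\<sigma> \<in> K"
    using T K(1) unfolding abstract_simplicial_complex_def by blast
  have "0 < flag_weight K x \<sigma>"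
    unfolding flag_weight_pos_iff [where x = x, OF K \<sigma> x0]
    using m le by (auto simp: \<sigma>_def order_less_le)
  with \<sigma> show ?thesis
    by (auto simp: flag_support_def)
qed

lemma flag_neighbourhood_self:
  assumes "abstract_simplicial_complex K" "finite K"
  shows "flag_neighbourhood K K = topspace (geometric_realization K)"
  using flag_support_nonempty [OF assms] by (auto simp: flag_neighbourhood_def)

text \<open>Some weight on \<open>U\<close> must be positive, so this is a union of preimages of an
  open half-line.\<close>

lemma openin_flag_neighbourhood:
  assumes K: "abstract_simplicial_complex K" "finite K" and "U \<subseteq> K"
  shows "openin (geometric_realization K) (flag_neighbourhood K U)"
proof -
  have "flag_neighbourhood K U =
      (\<Union>\<sigma>\<in>U. {x \<in> topspace (geometric_realization K). flag_weight K x \<sigma> \<in> {0<..}})"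
    by (auto simp: flag_neighbourhood_def flag_support_def)
  moreover have "openin (geometric_realization K)
      {x \<in> topspace (geometric_realization K). flag_weight K x \<sigma> \<in> {0<..}}" if "\<sigma> \<in> U" for \<sigma>
    using assms that
    by (intro openin_continuous_map_preimage [OF continuous_map_flag_weight]) auto
  ultimately show ?thesis
    by auto
qed

section \<open>Comparison of the two categories\<close>

lemma categorical_open_flag_neighbourhood:
  assumes K: "abstract_simplicial_complex K" "finite K" and U: "categorical_subcomplex K U"
  shows "categorical_open (geometric_realization K) (flag_neighbourhood K U)"
proof -
  let ?X = "geometric_realization K" and ?W = "flag_neighbourhood K U"
  obtain u where u: "{u} \<in> K" and cc: "same_contiguity_class U K (\<lambda>x. x) (\<lambda>_. u)"
    and sub: "subcomplex U K"
    using U by (auto simp: categorical_subcomplex_def vertices_def)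
  then have UK: "abstract_simplicial_complex U" "U \<subseteq> K" "finite U"
    using K finite_subset by (auto simp: subcomplex_def)
  have sdU: "abstract_simplicial_complex (sd U)" "finite (sd U)"
    using UK by (simp_all add: simplicial_complex_sd finite_sd)
  define r where "r = realization_map (sd U) some_vertex \<circ> flag_map K U"
  have r: "continuous_map (subtopology ?X ?W) (geometric_realization U) r"
    unfolding r_def
    by (intro continuous_map_compose [OF continuous_map_flag_map]
        continuous_map_realization_map simplicial_map_some_vertex K sub sdU UK)
  have topU: "r x \<in> topspace (geometric_realization U)" if "x \<in> topspace (subtopology ?X ?W)" for x
    using r that by (auto simp: continuous_map_def)
  define e where "e = (\<lambda>w. if w = u then 1 else 0 :: real)"
  have "homotopic_with (\<lambda>_. True) (subtopology ?X ?W) ?X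
      (realization_map U (\<lambda>x. x) \<circ> r) (realization_map U (\<lambda>_. u) \<circ> r)"
    by (rule homotopic_with_compose_continuous_map_right [OF _ r])
      (use homotopic_realization_same_contiguity_class [OF UK(1,3) K cc] in auto)
  \<comment> \<open>On |U| the realized inclusion is the identity, and the realized constant map is
    the point \<open>e\<close>, the vertex \<open>u\<close> in barycentric coordinates.\<close>
  then have r_e: "homotopic_with (\<lambda>_. True) (subtopology ?X ?W) ?X r (\<lambda>_. e)"
    by (rule homotopic_with_eq)
      (use topU in \<open>simp_all add: realization_map_id realization_map_const UK e_def\<close>)
  have "homotopic_with (\<lambda>_. True) (subtopology ?X ?W) ?X (\<lambda>x. x) r"
  proof (rule homotopic_common_carrier)
    \<comment> \<open>So far \<open>r\<close> was continuous into |U|; continuity into |K| is read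
      off the homotopy just found.\<close>
    show "continuous_map (subtopology ?X ?W) ?X r"
      using homotopic_with_imp_continuous_maps [OF r_e] by blast
    show "continuous_map (subtopology ?X ?W) ?X (\<lambda>x. x)"
      by (simp add: continuous_map_from_subtopology)
    fix x assume "x \<in> topspace (subtopology ?X ?W)"
    then have x: "x \<in> topspace ?X" "x \<in> ?W"
      by auto
    let ?T = "{v. x v \<noteq> 0}" and ?S = "flag_support K U x"
    have S: "?S \<in> sd U"
      using flag_support_in_sd [OF K sub x(2)] .
    \<comment> \<open>The picked vertices belong to the carrier of \<open>x\<close>, which is
      therefore the common simplex.\<close>
    have "r x \<in> closed_simplex (some_vertex ` ?S)"
      unfolding r_def o_def
      by (intro realization_map_closed_simplex sdU S flag_map_closed_simplex UK x)
    moreover have "some_vertex ` ?S \<subseteq> ?T"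
      using some_vertex_image_subset [OF UK(1) S] flag_support_subset_support [OF K sub x(1)] by blast
    moreover have T: "?T \<in> K" "x \<in> closed_simplex ?T"
      using support_in_complex [OF K(1) x(1)] .
    moreover have "finite ?T"
      using T K by (auto simp: abstract_simplicial_complex_def)
    ultimately show "\<exists>\<sigma>\<in>K. x \<in> closed_simplex \<sigma> \<and> r x \<in> closed_simplex \<sigma>"
      using closed_simplex_mono by blast
  qed (rule K)
  then have "homotopic_with (\<lambda>_. True) (subtopology ?X ?W) ?X (\<lambda>x. x) (\<lambda>_. e)"
    using r_e by (rule homotopic_with_trans)
  moreover have "e \<in> topspace ?X"
    using u by (auto simp: topspace_geometric_realization closed_simplex_def e_def intro!: bexI [of _ "{u}"])
  ultimately show ?thesis
    using openin_flag_neighbourhood [OF K UK(2)] by (auto simp: categorical_open_def)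
qed

lemma LS_cat_le_scat:
  assumes K: "abstract_simplicial_complex K" "finite K"
  shows "LS_cat (geometric_realization K) \<le> scat K"
  unfolding LS_cat_def scat_def
proof (rule INF_superset_mono)
  show "{n. \<exists>U. (\<forall>i\<le>n. categorical_subcomplex K (U i)) \<and> (\<Union>i\<le>n. U i) = K}
      \<subseteq> {n. \<exists>U. (\<forall>i\<le>n. categorical_open (geometric_realization K) (U i)) \<and>
          (\<Union>i\<le>n. U i) = topspace (geometric_realization K)}"
  proof
    fix n assume "n \<in> {n. \<exists>U. (\<forall>i\<le>n. categorical_subcomplex K (U i)) \<and> (\<Union>i\<le>n. U i) = K}"
    then obtain U where cat: "\<forall>i\<le>n. categorical_subcomplex K (U i)" and cov: "(\<Union>i\<le>n. U i) = K"
      by auto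
    \<comment> \<open>Membership asks for one simplex of positive weight, and each simplex of
      \<open>K\<close> lies in some \<open>U i\<close>.\<close>
    have "(\<Union>i\<le>n. flag_neighbourhood K (U i)) = flag_neighbourhood K K"
      unfolding flag_neighbourhood_def flag_support_def cov [symmetric] by auto
    then have "(\<Union>i\<le>n. flag_neighbourhood K (U i)) = topspace (geometric_realization K)"
      by (simp add: flag_neighbourhood_self [OF K])
    moreover have "\<forall>i\<le>n. categorical_open (geometric_realization K) (flag_neighbourhood K (U i))"
      using cat categorical_open_flag_neighbourhood [OF K] by blast
    ultimately show "n \<in> {n. \<exists>V. (\<forall>i\<le>n. categorical_open (geometric_realization K) (V i)) \<and>
        (\<Union>i\<le>n. V i) = topspace (geometric_realization K)}"
      by (intro CollectI exI [of _ "\<lambda>i. flag_neighbourhood K (U i)"] conjI)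
  qed
qed simp

section \<open>Domination by relabelled and iterated subdivisions\<close>

lemma finite_relabel: "finite K \<Longrightarrow> finite (relabel f K)"
  by (simp add: relabel_def)

lemma LS_cat_relabel_le:
  assumes K: "abstract_simplicial_complex K" "finite K" and j: "inj_on j (\<Union>K)"
  shows "LS_cat (geometric_realization K) \<le> LS_cat (geometric_realization (relabel j K))"
proof (rule LS_cat_le_dominated)
  let ?R = "relabel j K" and ?i = "inv_into (\<Union>K) j"
  have R: "abstract_simplicial_complex ?R" "finite ?R"
    using K by (simp_all add: simplicial_complex_relabel finite_relabel)
  have ij: "?i ` j ` \<sigma> = \<sigma>" if "\<sigma> \<in> K" for \<sigma>
    using that j by (intro inv_into_image_cancel) auto
  show f: "continuous_map (geometric_realization K) (geometric_realization ?R) (realization_map K j)"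
    using K R by (intro continuous_map_realization_map) (auto simp: simplicial_map_def relabel_def)
  show g: "continuous_map (geometric_realization ?R) (geometric_realization K) (realization_map ?R ?i)"
    using K R ij by (intro continuous_map_realization_map) (auto simp: simplicial_map_def relabel_def)
  show "homotopic_with (\<lambda>_. True) (geometric_realization K) (geometric_realization K)
      (\<lambda>x. x) (realization_map ?R ?i \<circ> realization_map K j)"
  proof (rule homotopic_common_carrier)
    fix x assume "x \<in> topspace (geometric_realization K)"
    then obtain \<sigma> where \<sigma>: "\<sigma> \<in> K" "x \<in> closed_simplex \<sigma>"
      by (auto simp: topspace_geometric_realization)
    \<comment> \<open>The round trip maps each simplex onto itself, so \<open>\<sigma>\<close> is a
      common carrier and the composite need not be computed.\<close>
    have "realization_map ?R ?i (realization_map K j x) \<in> closed_simplex (?i ` j ` \<sigma>)"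
      using R \<sigma> by (intro realization_map_closed_simplex K) (auto simp: relabel_def)
    with \<sigma> show "\<exists>\<sigma>\<in>K. x \<in> closed_simplex \<sigma> \<and>
        (realization_map ?R ?i \<circ> realization_map K j) x \<in> closed_simplex \<sigma>"
      by (auto simp: ij)
  qed (use K continuous_map_compose [OF f g] in auto)
qed

text \<open>The normalized weights with \<open>U = K\<close> are defined on all of |K|; followed by
  the vertex choice they stay in the carrier of each point.\<close>

lemma LS_cat_sd_le:
  assumes K: "abstract_simplicial_complex K" "finite K"
  shows "LS_cat (geometric_realization K) \<le> LS_cat (geometric_realization (sd K))"
proof (rule LS_cat_le_dominated)
  have KK: "subcomplex K K"
    using K by (simp add: subcomplex_def)
  have sdK: "abstract_simplicial_complex (sd K)" "finite (sd K)"
    using K by (simp_all add: simplicial_complex_sd finite_sd)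
  show f: "continuous_map (geometric_realization K) (geometric_realization (sd K)) (flag_map K K)"
    using continuous_map_flag_map [OF K KK] by (simp add: flag_neighbourhood_self [OF K])
  show g: "continuous_map (geometric_realization (sd K)) (geometric_realization K)
      (realization_map (sd K) some_vertex)"
    by (intro continuous_map_realization_map sdK K simplicial_map_some_vertex)
  show "homotopic_with (\<lambda>_. True) (geometric_realization K) (geometric_realization K)
      (\<lambda>x. x) (realization_map (sd K) some_vertex \<circ> flag_map K K)"
  proof (rule homotopic_common_carrier)
    fix x assume x: "x \<in> topspace (geometric_realization K)"
    then have W: "x \<in> flag_neighbourhood K K"
      by (simp add: flag_neighbourhood_self [OF K])
    let ?T = "{v. x v \<noteq> 0}" and ?S = "flag_support K K x"
    have S: "?S \<in> sd K"
      using flag_support_in_sd [OF K KK W] .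
    have "realization_map (sd K) some_vertex (flag_map K K x) \<in> closed_simplex (some_vertex ` ?S)"
      by (intro realization_map_closed_simplex sdK S flag_map_closed_simplex K W)
    moreover have "some_vertex ` ?S \<subseteq> ?T"
      using some_vertex_image_subset [OF K(1) S] flag_support_subset_support [OF K KK x] by blast
    moreover have T: "?T \<in> K" "x \<in> closed_simplex ?T"
      using support_in_complex [OF K(1) x] .
    moreover have "finite ?T"
      using T K by (auto simp: abstract_simplicial_complex_def)
    ultimately show "\<exists>\<sigma>\<in>K. x \<in> closed_simplex \<sigma> \<and>
        (realization_map (sd K) some_vertex \<circ> flag_map K K) x \<in> closed_simplex \<sigma>"
      using closed_simplex_mono by fastforce
  qed (use K continuous_map_compose [OF f g] in auto)
qed

lemma finite_sd_iter: "finite K \<Longrightarrow> finite (sd_iter N K)"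
  by (induction N) (simp_all add: finite_relabel finite_sd)

lemma LS_cat_sd_iter_le:
  assumes K: "abstract_simplicial_complex K" "finite K"
  shows "LS_cat (geometric_realization K) \<le> LS_cat (geometric_realization (sd_iter N K))"
proof (induction N)
  case 0
  have "inj_on Orig (\<Union>K)"
    by (simp add: inj_on_def)
  then show ?case
    using LS_cat_relabel_le [OF K] by simp
next
  case (Suc N)
  let ?L = "sd_iter N K"
  have L: "abstract_simplicial_complex ?L" "finite ?L"
    using K by (simp_all add: simplicial_complex_sd_iter finite_sd_iter)
  \<comment> \<open>Vertices of the subdivision are simplices of \<open>sd_iter N K\<close>, hence
    finite sets, on which the coding is injective.\<close>
  have "\<Union>(sd ?L) \<subseteq> ?L"
    by (auto simp: sd_def)
  then have "inj_on (\<lambda>\<sigma>. Simplex (Abs_fset \<sigma>)) (\<Union>(sd ?L))"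
    using inj_on_Simplex_Abs_fset [OF L(1)] inj_on_subset by blast
  then have "LS_cat (geometric_realization (sd ?L)) \<le> LS_cat (geometric_realization (sd_iter (Suc N) K))"
    using LS_cat_relabel_le [of "sd ?L"] L by (simp add: simplicial_complex_sd finite_sd)
  with Suc LS_cat_sd_le [OF L] show ?case
    using order_trans by blast
qed

theorem corollary4p2p2:
  fixes K :: "'a set set" and N :: nat
  assumes "abstract_simplicial_complex K" and "finite K"
  shows "LS_cat (geometric_realization K) \<le> scat (sd_iter N K)"
proof -
  \<comment> \<open>The comparison of categories is applied to the subdivided complex itself;
    domination then brings the bound back to |K|.\<close>
  have "LS_cat (geometric_realization (sd_iter N K)) \<le> scat (sd_iter N K)"
    using assms by (intro LS_cat_le_scat simplicial_complex_sd_iter finite_sd_iter)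
  then show ?thesis
    using LS_cat_sd_iter_le [OF assms] order_trans by blast
qed

end
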